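(* Consider the problem $\min_{\mathbf{x}\in\mathcal{X}}\max_{|S|\le k}f(\mathbf{x},S)$, where $\mathcal{X}\subset\mathbb{R}^d$ is convex and bounded, and $f:\mathbb{R}^d\times2^V\to\mathbb{R}_+$ is convex in $\mathbf{x}$ and monotone submodular in $S$. Suppose that: (1) there is $L$ such that $\|\nabla_{\mathbf{x}}f(\mathbf{x},S)-\nabla_{\mathbf{x}}f(\mathbf{x}',S)\|\le L\|\mathbf{x}-\mathbf{x}'\|$ for all $\mathbf{x},\mathbf{x}'\in\mathbb{R}^d$ and all $S$ with $|S|\le k$; (2) there is $M$ such that $\|\nabla_{\mathbf{x}}f(\mathbf{x},S)\|\le M$ for all $\mathbf{x}\in\mathbb{R}^d$ and $S\in2^V$. Then the output $\mathbf{x}_{sol}$ of the Extra-Gradient Replacement-Greedy (EGRG) algorithm after $\mathcal{O}(1/\epsilon^2)$ iterations with step size $\mathcal{O}(\epsilon)$ is a $(1/2,\epsilon)$-approximate minimax solution, i.e. $$\tfrac12\max_{|S|\le k}f(\mathbf{x}_{sol},S)\le \min_{\mathbf{x}\in\mathcal{X}}\max_{|S|\le k}f(\mathbf{x},S)+\epsilon .$$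
   Context: $V$ is a finite ground set with $n$ elements and $k\le n$ is a positive integer. A set function $g:2^V\to\mathbb{R}$ is submodular if $g(A\cap B)+g(A\cup B)\le g(A)+g(B)$ for all $A,B\subseteq V$, and monotone if $g(A)\le g(B)$ whenever $A\subseteq B$. $\pi_{\mathcal{X}}$ denotes Euclidean projection onto $\mathcal{X}$ (assumed well defined), and $\nabla f(\mathbf{x},S)=\nabla_{\mathbf{x}}f(\mathbf{x},S)$. Replacement greedy subroutine $\textsc{RepGreedy}(f,k,\mathbf{x},S)$: let $\Delta_ef(\mathbf{x},S)=f(\mathbf{x},S\cup\{e\})-f(\mathbf{x},S)$. If $|S|<k$, return $S^+=S\cup\{\arg\max_{e\in V}\Delta_ef(\mathbf{x},S)\}$. If $|S|=k$, let $e^*=\arg\max_{e\in S}f(\mathbf{x},S\setminus\{e\})$ and return $S^+=(S\setminus\{e^*\})\cup\{\arg\max_{e\in V}\Delta_ef(\mathbf{x},S\setminus\{e^*\})\}$. Extra-Gradient Replacement-Greedy (EGRG): initialize $S_1=\emptyset$, $\mathbf{x}_1=\mathbf{0}$. For $t=1,\dots,T$: $\hat{\mathbf{x}}_t=\pi_{\mathcal{X}}(\mathbf{x}_t-\gamma_t\nabla f(\mathbf{x}_t,S_t))$, $\hat S_t=\textsc{RepGreedy}(f,k,\mathbf{x}_t,S_t)$, $\mathbf{x}_{t+1}=\pi_{\mathcal{X}}(\mathbf{x}_t-\gamma_t\nabla f(\hat{\mathbf{x}}_t,\hat S_t))$, $S_{t+1}=\textsc{RepGreedy}(f,k,\hat{\mathbf{x}}_t,\hat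 S_t)$, where $\gamma_t>0$ are step sizes. Output $\mathbf{x}_{sol}=\big(\sum_{t=1}^T\gamma_t\big)^{-1}\sum_{t=1}^T\gamma_t\hat{\mathbf{x}}_t$. Meaning of the asymptotic statement: there are constants, independent of $\epsilon$ (they may depend on $f,\mathcal{X},k$ and the constants in the hypotheses), such that for all sufficiently small $\epsilon>0$ the conclusion holds for a suitable number of iterations $T$ that is at most a constant times $1/\epsilon^2$ and suitable step sizes at most a constant times $\epsilon$. *)

theory Defs
  imports "HOL-Analysis.Analysis"
begin

definition submodular_on :: "'v set \<Rightarrow> ('v set \<Rightarrow> real) \<Rightarrow> bool" where
  "submodular_on V g \<longleftrightarrow>
     (\<forall>A B. A \<subseteq> V \<longrightarrow> B \<subseteq> V \<longrightarrow> g (A \<inter> B) + g (A \<union> B) \<le> g A + g B)"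

definition marginal :: "('a \<Rightarrow> 'v set \<Rightarrow> real) \<Rightarrow> 'a \<Rightarrow> 'v set \<Rightarrow> 'v \<Rightarrow> real" where
  "marginal f x S e = f x (S \<union> {e}) - f x S"

text \<open>Argmax ties are left open: the subroutine is the relation between its input \<open>S\<close> and all
  outputs \<open>S'\<close> that some choice of maximizers can produce.\<close>

definition rep_greedy ::
  "'v set \<Rightarrow> ('a \<Rightarrow> 'v set \<Rightarrow> real) \<Rightarrow> nat \<Rightarrow> 'a \<Rightarrow> 'v set \<Rightarrow> 'v set \<Rightarrow> bool" where
  "rep_greedy V f k x S S' \<longleftrightarrow>
     (card S < k \<and>
        (\<exists>e. is_arg_max (marginal f x S) (\<lambda>e. e \<in> V) e \<and> S' = S \<union> {e})) \<or>
     (card S = k \<and>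
        (\<exists>e' e. is_arg_max (\<lambda>e. f x (S - {e})) (\<lambda>e. e \<in> S) e' \<and>
                is_arg_max (marginal f x (S - {e'})) (\<lambda>e. e \<in> V) e \<and>
                S' = (S - {e'}) \<union> {e}))"

text \<open>\<open>grad x S\<close> stands for the gradient of \<open>\<lambda>x. f x S\<close> at \<open>x\<close>; \<open>xh\<close> and \<open>Sh\<close> are the
  extrapolated iterates. Iterations are numbered from 1, so \<open>x\<close> and \<open>S\<close> are constrained on
  \<open>1, \<dots>, T + 1\<close> and \<open>xh\<close>, \<open>Sh\<close> on \<open>1, \<dots>, T\<close>. The starting point 0 need not lie in \<open>X\<close>.\<close>

definition egrg_run ::
  "'v set \<Rightarrow> ('a::euclidean_space \<Rightarrow> 'v set \<Rightarrow> real) \<Rightarrow> ('a \<Rightarrow> 'v set \<Rightarrow> 'a) \<Rightarrow> nat \<Rightarrow> 'a set \<Rightarrow>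
   (nat \<Rightarrow> real) \<Rightarrow> nat \<Rightarrow>
   (nat \<Rightarrow> 'a) \<Rightarrow> (nat \<Rightarrow> 'a) \<Rightarrow> (nat \<Rightarrow> 'v set) \<Rightarrow> (nat \<Rightarrow> 'v set) \<Rightarrow> bool" where
  "egrg_run V f grad k X \<gamma> T x xh S Sh \<longleftrightarrow>
     S 1 = {} \<and> x 1 = 0 \<and>
     (\<forall>t\<in>{1..T}.
        xh t = closest_point X (x t - \<gamma> t *\<^sub>R grad (x t) (S t)) \<and>
        rep_greedy V f k (x t) (S t) (Sh t) \<and>
        x (Suc t) = closest_point X (x t - \<gamma> t *\<^sub>R grad (xh t) (Sh t)) \<and>
        rep_greedy V f k (xh t) (Sh t) (S (Suc t)))"

definition egrg_output :: "(nat \<Rightarrow> real) \<Rightarrow> nat \<Rightarrow> (nat \<Rightarrow> 'a::real_vector) \<Rightarrow> 'a" where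
  "egrg_output \<gamma> T xh = inverse (\<Sum>t=1..T. \<gamma> t) *\<^sub>R (\<Sum>t=1..T. \<gamma> t *\<^sub>R xh t)"

definition max_value :: "'v set \<Rightarrow> ('a \<Rightarrow> 'v set \<Rightarrow> real) \<Rightarrow> nat \<Rightarrow> 'a \<Rightarrow> real" where
  "max_value V f k x = (MAX S\<in>{S. S \<subseteq> V \<and> card S \<le> k}. f x S)"

text \<open>The infimum is a minimum whenever \<open>X\<close> is nonempty and compact and \<open>f\<close> is continuous in its
  first argument.\<close>

definition approx_minimax ::
  "'v set \<Rightarrow> ('a \<Rightarrow> 'v set \<Rightarrow> real) \<Rightarrow> nat \<Rightarrow> 'a set \<Rightarrow> real \<Rightarrow> real \<Rightarrow> 'a \<Rightarrow> bool" where
  "approx_minimax V f k X \<alpha> \<epsilon> x \<longleftrightarrow>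
     \<alpha> * max_value V f k x \<le> (INF y\<in>X. max_value V f k y) + \<epsilon>"

lemma rep_greedy_exists:
  fixes V :: "'v set"
  assumes "finite V" "1 \<le> k" "k \<le> card V" "S \<subseteq> V" "card S \<le> k"
  shows "\<exists>S'. rep_greedy V f k x S S' \<and> S' \<subseteq> V \<and> card S' \<le> k"
proof -
  have fS: "finite S" using assms finite_subset by blast
  have am: "\<exists>e. is_arg_max g (\<lambda>e. e \<in> A) e" if "finite A" "A \<noteq> {}" for A and g :: "'v \<Rightarrow> real"
  proof -
    have "Max (g ` A) \<in> g ` A" using that by simp
    then obtain e where "e \<in> A" "Max (g ` A) = g e" by blast
    then show ?thesis
      using Max_ge[of "g ` A"] that(1) by (auto simp: is_arg_max_linorder intro!: exI[of _ e])
  qed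
  have V: "V \<noteq> {}" using assms by auto
  show ?thesis
  proof (cases "card S < k")
    case True
    obtain e where e: "is_arg_max (marginal f x S) (\<lambda>e. e \<in> V) e"
      using am[OF assms(1) V] by blast
    have "rep_greedy V f k x S (S \<union> {e})"
      using True e unfolding rep_greedy_def by blast
    moreover have "card (S \<union> {e}) \<le> k"
      using True fS by (simp add: card_insert_if)
    moreover have "e \<in> V" using e by (simp add: is_arg_max_def)
    ultimately show ?thesis using assms(4) by blast
  next
    case False
    then have k: "card S = k" using assms by simp
    then have "S \<noteq> {}" using assms by auto
    then obtain d where d: "is_arg_max (\<lambda>e. f x (S - {e})) (\<lambda>e. e \<in> S) d"
      using am[OF fS] by blast
    obtain e where e: "is_arg_max (marginal f x (S - {d})) (\<lambda>e. e \<in> V) e"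
      using am[OF assms(1) V] by blast
    have "rep_greedy V f k x S (S - {d} \<union> {e})"
      using k d e unfolding rep_greedy_def by blast
    moreover have "d \<in> S" "e \<in> V" using d e by (simp_all add: is_arg_max_def)
    moreover from this have "card (S - {d} \<union> {e}) \<le> k"
      using fS k assms(2) by (simp add: card_insert_if)
    ultimately show ?thesis using assms(4) by blast
  qed
qed

lemma egrg_run_exists:
  assumes "finite V" "1 \<le> k" "k \<le> card V"
  shows "\<exists>x xh S Sh. egrg_run V f grad k X \<gamma> T x xh S Sh"
proof -
  define R where "R x S = (SOME S'. rep_greedy V f k x S S' \<and> S' \<subseteq> V \<and> card S' \<le> k)" for x S
  have R: "rep_greedy V f k x S (R x S)" "R x S \<subseteq> V" "card (R x S) \<le> k"
    if "S \<subseteq> V" "card S \<le> k" for x S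
    using someI_ex[OF rep_greedy_exists[OF assms that, of f x]] unfolding R_def by blast+
  define h where "h t x S = closest_point X (x - \<gamma> t *\<^sub>R grad x S)" for t x S
  define step where "step t p = (case p of (x, S) \<Rightarrow>
      (closest_point X (x - \<gamma> t *\<^sub>R grad (h t x S) (R x S)), R (h t x S) (R x S)))" for t p
  define Q where "Q t = rec_nat (0, {}) (\<lambda>n p. step (Suc n) p) (t - 1)" for t :: nat
  have Q1: "Q 1 = (0, {})" by (simp add: Q_def)
  have QS: "Q (Suc t) = step t (Q t)" if "t \<ge> 1" for t
    using that by (cases t) (simp_all add: Q_def)
  have inv: "snd (Q t) \<subseteq> V \<and> card (snd (Q t)) \<le> k" if "t \<ge> 1" for t
    using that
  proof (induction t rule: dec_induct)
    case base
    then show ?case using Q1 by simp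
  next
    case (step t)
    then show ?case using R QS[of t] by (simp add: step_def case_prod_beta)
  qed
  have "egrg_run V f grad k X \<gamma> T (\<lambda>t. fst (Q t)) (\<lambda>t. h t (fst (Q t)) (snd (Q t)))
          (\<lambda>t. snd (Q t)) (\<lambda>t. R (fst (Q t)) (snd (Q t)))"
    unfolding egrg_run_def
    using Q1 QS R inv by (auto simp: step_def h_def case_prod_beta)
  then show ?thesis by blast
qed

end

theory Submission
  imports Defs
begin

text \<open>Two regret bounds, one for each player, are added up along the run with a constant step size.

  The maximizer. A replacement step never decreases the value of the current set, because the
  removed element may be put back, and it satisfies
  \<open>k (f x S' - f x S) \<ge> f x A - 2 f x S\<close> for every \<open>A\<close> with at most \<open>k\<close> elements
  (\<open>rep_greedy_progress\<close>): by submodularity the cheapest element of a full set \<open>S\<close> carries at most a fraction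
  \<open>1/k\<close> of the value of \<open>S\<close>, and the best new element gains at least a fraction \<open>1/k\<close> of what
  \<open>A\<close> is worth more than the remaining set. Apply this at \<open>xh t\<close> to the step from \<open>Sh t\<close> to
  \<open>S (t + 1)\<close>. Since \<open>Sh (t + 1)\<close> is in turn no worse than \<open>S (t + 1)\<close> at \<open>x (t + 1)\<close>, and since the
  points \<open>xh t\<close>, \<open>x (t + 1)\<close>, \<open>xh (t + 1)\<close> are within \<open>O(\<gamma>)\<close> of each other while \<open>f\<close> is
  \<open>M\<close>-Lipschitz, the values \<open>f (xh t) (Sh t)\<close> telescope up to \<open>O(\<gamma>)\<close> per step
  (\<open>set_player_regret\<close>).

  The minimizer. The points \<open>x t\<close> perform projected gradient descent with gradients taken at the
  points \<open>xh t\<close>, which are \<open>O(\<gamma>)\<close>-close except possibly for \<open>t = 1\<close>, so the usual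
  potential \<open>(norm (x t - z))\<^sup>2\<close> gives a regret of \<open>O(1/\<gamma> + \<gamma> T)\<close> against any \<open>z \<in> X\<close> (\<open>point_player_regret\<close>).

  Dividing by \<open>T\<close> and using Jensen's inequality for the averaged point bounds half of the maximum at
  the output by the maximum at \<open>z\<close> plus \<open>O(1/(\<gamma> T) + \<gamma> + 1/T)\<close> (\<open>egrg_gap\<close>), which is at most
  \<open>\<epsilon>\<close> for \<open>\<gamma>\<close> proportional to \<open>\<epsilon>\<close> and \<open>T\<close> proportional to \<open>1/\<epsilon>\<^sup>2\<close>.\<close>

section \<open>Submodular functions and the replacement step\<close>

lemma submodular_on_sum_marginals_ge:
  assumes "submodular_on V g" "finite A" "A \<subseteq> V" "S \<subseteq> V"
  shows "g (S \<union> A) - g S \<le> (\<Sum>e\<in>A. g (S \<union> {e}) - g S)"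
  using assms(2,3)
proof (induction A rule: finite_induct)
  case empty
  then show ?case by simp
next
  case (insert e A)
  have sub: "g ((S \<union> A) \<inter> (S \<union> {e})) + g ((S \<union> A) \<union> (S \<union> {e})) \<le> g (S \<union> A) + g (S \<union> {e})"
    using assms(1)[unfolded submodular_on_def, rule_format, of "S \<union> A" "S \<union> {e}"]
      assms(4) insert.prems by simp
  have "(S \<union> A) \<inter> (S \<union> {e}) = S" "(S \<union> A) \<union> (S \<union> {e}) = S \<union> insert e A"
    using insert.hyps by auto
  then show ?case using sub insert by simp
qed

lemma submodular_on_sum_removals_le:
  assumes "submodular_on V g" "finite A" "A \<subseteq> S" "S \<subseteq> V"
  shows "(\<Sum>e\<in>A. g S - g (S - {e})) \<le> g S - g (S - A)"
  using assms(2,3)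
proof (induction A rule: finite_induct)
  case empty
  then show ?case by simp
next
  case (insert e A)
  have sub: "g ((S - A) \<inter> (S - {e})) + g ((S - A) \<union> (S - {e})) \<le> g (S - A) + g (S - {e})"
    using assms(1,4) unfolding submodular_on_def by (meson Diff_subset subset_trans)
  have "(S - A) \<inter> (S - {e}) = S - insert e A" "(S - A) \<union> (S - {e}) = S"
    using insert.hyps insert.prems by auto
  then show ?case using sub insert by simp
qed

lemma greedy_addition_progress:
  assumes fin: "finite V" and mono: "mono_on (Pow V) (f x)" and sub: "submodular_on V (f x)"
    and S: "S \<subseteq> V" and A: "A \<subseteq> V" "card A \<le> k"
    and e: "is_arg_max (marginal f x S) (\<lambda>e. e \<in> V) e"
  shows "f x A - f x S \<le> real k * (f x (S \<union> {e}) - f x S)"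
proof -
  have eV: "e \<in> V" and best: "marginal f x S a \<le> marginal f x S e" if "a \<in> V" for a
    using e that by (auto simp: is_arg_max_linorder)
  have finA: "finite A" using A(1) fin finite_subset by blast
  have nonneg: "0 \<le> marginal f x S e"
    using monotone_onD[OF mono, of S "S \<union> {e}"] S e
    by (auto simp: marginal_def is_arg_max_linorder)
  have "f x A \<le> f x (S \<union> A)"
    using monotone_onD[OF mono, of A "S \<union> A"] S A by auto
  also have "\<dots> - f x S \<le> (\<Sum>a\<in>A. marginal f x S a)"
    using submodular_on_sum_marginals_ge[OF sub finA A(1) S] by (simp add: marginal_def)
  also have "\<dots> \<le> real (card A) * marginal f x S e"
    using sum_bounded_above[of A "marginal f x S" "marginal f x S e"] best A by auto
  also have "\<dots> \<le> real k * marginal f x S e"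
    using A(2) nonneg by (simp add: mult_right_mono)
  finally show ?thesis by (simp add: marginal_def)
qed

lemma cheapest_removal_loss:
  assumes fin: "finite S" and sub: "submodular_on V g" and S: "S \<subseteq> V"
    and e: "is_arg_max (\<lambda>e. g (S - {e})) (\<lambda>e. e \<in> S) e"
  shows "real (card S) * (g S - g (S - {e})) \<le> g S - g {}"
proof -
  have "real (card S) * (g S - g (S - {e})) \<le> (\<Sum>a\<in>S. g S - g (S - {a}))"
    using sum_bounded_below[of S "g S - g (S - {e})" "\<lambda>a. g S - g (S - {a})"] e
    by (auto simp: is_arg_max_linorder)
  also have "\<dots> \<le> g S - g {}"
    using submodular_on_sum_removals_le[OF sub fin subset_refl S] by simp
  finally show ?thesis .
qed

lemma rep_greedy_feasible:
  assumes "rep_greedy V f k x S S'" "finite V" "1 \<le> k" "S \<subseteq> V"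
  shows "S' \<subseteq> V" "card S' \<le> k"
proof -
  have fS: "finite S" using assms finite_subset by blast
  show "S' \<subseteq> V" using assms by (auto simp: rep_greedy_def is_arg_max_linorder)
  show "card S' \<le> k"
    using assms fS by (auto simp: rep_greedy_def is_arg_max_linorder card_insert_if)
qed

lemma rep_greedy_increasing:
  assumes "rep_greedy V f k x S S'" and mono: "mono_on (Pow V) (f x)" and S: "S \<subseteq> V"
  shows "f x S \<le> f x S'"
  using assms(1) unfolding rep_greedy_def
proof (elim disjE conjE exE)
  fix e assume "is_arg_max (marginal f x S) (\<lambda>e. e \<in> V) e" "S' = S \<union> {e}"
  then show ?thesis
    using monotone_onD[OF mono, of S S'] S by (auto simp: is_arg_max_linorder)
next
  fix d e
  assume d: "is_arg_max (\<lambda>e. f x (S - {e})) (\<lambda>e. e \<in> S) d"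
    and e: "is_arg_max (marginal f x (S - {d})) (\<lambda>e. e \<in> V) e"
    and S': "S' = S - {d} \<union> {e}"
  \<comment> \<open>The removed element \<open>d\<close> is itself a candidate for insertion.\<close>
  have "marginal f x (S - {d}) d \<le> marginal f x (S - {d}) e"
    using d e S by (auto simp: is_arg_max_linorder)
  moreover have "S - {d} \<union> {d} = S" using d by (auto simp: is_arg_max_linorder)
  ultimately show ?thesis using S' by (simp add: marginal_def)
qed

text \<open>The factor 2 is the origin of the approximation ratio 1/2: one copy of \<open>f x S\<close> pays for the
  greedy insertion, the other one for the removal.\<close>

lemma rep_greedy_progress:
  assumes rg: "rep_greedy V f k x S S'"
    and fin: "finite V" and mono: "mono_on (Pow V) (f x)" and sub: "submodular_on V (f x)"
    and nonneg: "0 \<le> f x {}"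
    and S: "S \<subseteq> V" and A: "A \<subseteq> V" "card A \<le> k"
  shows "f x A - 2 * f x S \<le> real k * (f x S' - f x S)"
proof -
  have fS: "finite S" using S fin finite_subset by blast
  have pos: "0 \<le> f x S" using monotone_onD[OF mono, of "{}" S] S nonneg by simp
  show ?thesis
    using rg unfolding rep_greedy_def
  proof (elim disjE conjE exE)
    fix e assume "is_arg_max (marginal f x S) (\<lambda>e. e \<in> V) e" "S' = S \<union> {e}"
    then show ?thesis
      using greedy_addition_progress[of V f x S A k e] fin mono sub S A pos by simp
  next
    fix d e
    assume k: "card S = k" and d: "is_arg_max (\<lambda>e. f x (S - {e})) (\<lambda>e. e \<in> S) d"
      and e: "is_arg_max (marginal f x (S - {d})) (\<lambda>e. e \<in> V) e"
      and S': "S' = S - {d} \<union> {e}"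
    have "f x A - f x (S - {d}) \<le> real k * (f x S' - f x (S - {d}))"
      using greedy_addition_progress[OF fin mono sub _ A e] S S' by auto
    moreover have "real k * (f x S - f x (S - {d})) \<le> f x S"
      using cheapest_removal_loss[OF fS sub S d] nonneg k by simp
    moreover have "f x (S - {d}) \<le> f x S"
      using monotone_onD[OF mono, of "S - {d}" S] S by auto
    ultimately show ?thesis by (simp add: algebra_simps)
  qed
qed

section \<open>Convex functions and projected gradient steps\<close>

lemma convex_on_gderiv_above_tangent:
  fixes h :: "'a::real_inner \<Rightarrow> real"
  assumes conv: "convex_on UNIV h" and der: "GDERIV h x :> g"
  shows "h x + g \<bullet> (y - x) \<le> h y"
proof -
  define c where "c t = x + t *\<^sub>R (y - x)" for t
  have "convex_on UNIV (\<lambda>t. h (c t))"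
  proof (rule convex_onI)
    fix t a b :: real assume t: "0 < t" "t < 1"
    have "c ((1 - t) *\<^sub>R a + t *\<^sub>R b) = (1 - t) *\<^sub>R c a + t *\<^sub>R c b"
      by (simp add: c_def algebra_simps)
    then show "h (c ((1 - t) *\<^sub>R a + t *\<^sub>R b)) \<le> (1 - t) * h (c a) + t * h (c b)"
      using convex_onD[OF conv, of t "c a" "c b"] t by simp
  qed simp
  moreover have "((\<lambda>t. h (c t)) has_field_derivative g \<bullet> (y - x)) (at 0)"
  proof -
    have "(h has_derivative (\<lambda>v. v \<bullet> g)) (at (c 0))"
      using der by (simp add: gderiv_def c_def)
    moreover have "(c has_derivative (\<lambda>t. t *\<^sub>R (y - x))) (at 0)"
      unfolding c_def by (auto intro!: derivative_eq_intros)
    ultimately have "((\<lambda>t. h (c t)) has_derivative (\<lambda>t. (t *\<^sub>R (y - x)) \<bullet> g)) (at 0)"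
      by (rule has_derivative_compose[rotated])
    then show ?thesis
      unfolding has_field_derivative_def
      by (rule has_derivative_eq_rhs) (simp add: inner_commute fun_eq_iff)
  qed
  ultimately have "h (c 1) - h (c 0) \<ge> (g \<bullet> (y - x)) * (1 - 0)"
    by (intro convex_on_imp_above_tangent[of UNIV]) auto
  then show ?thesis by (simp add: c_def)
qed

lemma closest_point_step_dist:
  fixes X :: "'a::euclidean_space set"
  assumes "convex X" "closed X" "X \<noteq> {}"
  shows "norm (closest_point X (x - a) - closest_point X (x - b)) \<le> norm a + norm b"
proof -
  have "norm (closest_point X (x - a) - closest_point X (x - b)) \<le> norm ((x - a) - (x - b))"
    using closest_point_lipschitz[OF assms, of "x - a" "x - b"] by (simp add: dist_norm)
  also have "\<dots> \<le> norm a + norm b"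
    using norm_triangle_ineq4[of b a] by (simp add: algebra_simps)
  finally show ?thesis .
qed

lemma projected_gradient_step:
  fixes X :: "'a::euclidean_space set"
  assumes "convex X" "closed X" "z \<in> X"
  shows "2 * (g \<bullet> (x - z)) \<le> (norm (x - z))\<^sup>2 - (norm (closest_point X (x - g) - z))\<^sup>2 + (norm g)\<^sup>2"
proof -
  have "norm (closest_point X (x - g) - z) \<le> norm (x - g - z)"
    using closest_point_lipschitz[of X "x - g" z] assms closest_point_self[OF assms(3)]
    by (auto simp: dist_norm)
  then have "(norm (closest_point X (x - g) - z))\<^sup>2 \<le> (norm ((x - z) - g))\<^sup>2"
    by (simp add: algebra_simps power_mono)
  also have "\<dots> = (norm (x - z))\<^sup>2 - 2 * (g \<bullet> (x - z)) + (norm g)\<^sup>2"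
    by (simp add: power2_norm_eq_inner inner_diff inner_commute algebra_simps)
  finally show ?thesis by simp
qed

section \<open>Regret along a run\<close>

text \<open>The data of the minimax problem, with \<open>R\<close> a bound for the norm on \<open>X\<close> and \<open>M\<close> a bound for
  the gradients on the whole space. The latter is needed beyond \<open>X\<close>, since the starting point 0
  may lie outside \<open>X\<close>.\<close>

locale minimax_problem =
  fixes V :: "'v set" and k :: nat
    and X :: "'a::euclidean_space set"
    and f :: "'a \<Rightarrow> 'v set \<Rightarrow> real"
    and grad :: "'a \<Rightarrow> 'v set \<Rightarrow> 'a"
    and M R :: real
  assumes fin: "finite V" and k: "1 \<le> k"
    and X: "convex X" "closed X" "X \<noteq> {}"
    and R: "\<And>y. y \<in> X \<Longrightarrow> norm y \<le> R"
    and nonneg: "\<And>x S. S \<subseteq> V \<Longrightarrow> 0 \<le> f x S"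
    and conv: "\<And>S. S \<subseteq> V \<Longrightarrow> convex_on UNIV (\<lambda>x. f x S)"
    and mono: "\<And>x. mono_on (Pow V) (f x)"
    and sub: "\<And>x. submodular_on V (f x)"
    and der: "\<And>x S. S \<subseteq> V \<Longrightarrow> GDERIV (\<lambda>z. f z S) x :> grad x S"
    and bound: "\<And>x S. S \<subseteq> V \<Longrightarrow> norm (grad x S) \<le> M"
begin

lemma M_nonneg: "0 \<le> M"
  using bound[of "{}" 0] norm_ge_zero order_trans by blast

lemma tangent: "S \<subseteq> V \<Longrightarrow> f x S - f y S \<le> grad x S \<bullet> (x - y)"
  using convex_on_gderiv_above_tangent[OF conv der, of S x y] by (simp add: inner_diff)

lemma grad_inner_le: "S \<subseteq> V \<Longrightarrow> \<bar>grad x S \<bullet> v\<bar> \<le> M * norm v"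
  using Cauchy_Schwarz_ineq2[of "grad x S" v] bound[of S x]
  by (meson mult_right_mono norm_ge_zero order_trans)

lemma lipschitz: "S \<subseteq> V \<Longrightarrow> f x S \<le> f y S + M * norm (x - y)"
  using tangent[of S x y] grad_inner_le[of S x "x - y"] by linarith

lemma value_le_max_value:
  assumes "S \<subseteq> V" "card S \<le> k"
  shows "f x S \<le> max_value V f k x"
  unfolding max_value_def using assms fin by (intro Max_ge) auto

lemma max_value_leI:
  assumes "\<And>S. S \<subseteq> V \<Longrightarrow> card S \<le> k \<Longrightarrow> f x S \<le> b"
  shows "max_value V f k x \<le> b"
  unfolding max_value_def
proof (subst Max_le_iff)
  show "finite (f x ` {S. S \<subseteq> V \<and> card S \<le> k})" using fin by simp
  have "{} \<in> {S. S \<subseteq> V \<and> card S \<le> k}" by simp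
  then show "f x ` {S. S \<subseteq> V \<and> card S \<le> k} \<noteq> {}" by blast
qed (use assms in auto)

lemma values_bounded:
  obtains B where "0 \<le> B" "\<And>x S. x \<in> X \<Longrightarrow> S \<subseteq> V \<Longrightarrow> f x S \<le> B"
proof -
  obtain x0 where x0: "x0 \<in> X" using X by auto
  have "f x S \<le> f x0 V + M * (R + R)" if "x \<in> X" "S \<subseteq> V" for x S
  proof -
    have "f x S \<le> f x V" using monotone_onD[OF mono, of S V x] that by auto
    also have "\<dots> \<le> f x0 V + M * norm (x - x0)" by (rule lipschitz) simp
    also have "norm (x - x0) \<le> R + R"
      using norm_triangle_ineq4[of x x0] R[OF that(1)] R[OF x0] by linarith
    finally show ?thesis using M_nonneg by (simp add: mult_left_mono)
  qed
  moreover from this[OF x0, of "{}"] nonneg[of "{}" x0] have "0 \<le> f x0 V + M * (R + R)" by simp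
  ultimately show thesis using that by blast
qed

end

text \<open>A run of at least one iteration, with the same step size \<open>\<gamma>\<close> in all iterations.\<close>

locale minimax_run = minimax_problem V k X f grad M R
  for V :: "'v set" and k :: nat and X :: "'a::euclidean_space set"
    and f :: "'a \<Rightarrow> 'v set \<Rightarrow> real" and grad :: "'a \<Rightarrow> 'v set \<Rightarrow> 'a" and M R :: real +
  fixes \<gamma> :: real and T :: nat
    and x xh :: "nat \<Rightarrow> 'a" and S Sh :: "nat \<Rightarrow> 'v set"
  assumes \<gamma>: "0 < \<gamma>" and T: "1 \<le> T"
    and run: "egrg_run V f grad k X (\<lambda>_. \<gamma>) T x xh S Sh"
begin

lemma start: "S 1 = {}" "x 1 = 0"
  and steps: "t \<in> {1..T} \<Longrightarrow> xh t = closest_point X (x t - \<gamma> *\<^sub>R grad (x t) (S t))"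
    "t \<in> {1..T} \<Longrightarrow> rep_greedy V f k (x t) (S t) (Sh t)"
    "t \<in> {1..T} \<Longrightarrow> x (Suc t) = closest_point X (x t - \<gamma> *\<^sub>R grad (xh t) (Sh t))"
    "t \<in> {1..T} \<Longrightarrow> rep_greedy V f k (xh t) (Sh t) (S (Suc t))"
  using run unfolding egrg_run_def by blast+

lemma S_subset: "t \<in> {1..Suc T} \<Longrightarrow> S t \<subseteq> V"
proof (induction t)
  case 0
  then show ?case by simp
next
  case (Suc t)
  show ?case
  proof (cases "t = 0")
    case True
    then show ?thesis using start by simp
  next
    case False
    then have t: "t \<in> {1..T}" "S t \<subseteq> V" using Suc by auto
    show ?thesis
      using rep_greedy_feasible(1)[OF steps(2) fin k] rep_greedy_feasible(1)[OF steps(4) fin k] t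
      by blast
  qed
qed

lemma Sh_feasible: assumes "t \<in> {1..T}" shows "Sh t \<subseteq> V" "card (Sh t) \<le> k"
  using rep_greedy_feasible[OF steps(2)[OF assms] fin k] S_subset[of t] assms by auto

lemma xh_in: "t \<in> {1..T} \<Longrightarrow> xh t \<in> X"
  using steps(1) closest_point_in_set[OF X(2,3)] by metis

lemma x_Suc_in: "t \<in> {1..T} \<Longrightarrow> x (Suc t) \<in> X"
  using steps(3) closest_point_in_set[OF X(2,3)] by metis

lemma step_norm: "A \<subseteq> V \<Longrightarrow> norm (\<gamma> *\<^sub>R grad y A) \<le> \<gamma> * M"
  using \<gamma> bound[of A y] by simp

lemma dist_xh_x_Suc:
  assumes "t \<in> {1..T}" shows "norm (xh t - x (Suc t)) \<le> 2 * \<gamma> * M"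
proof -
  have "norm (xh t - x (Suc t)) \<le> norm (\<gamma> *\<^sub>R grad (x t) (S t)) + norm (\<gamma> *\<^sub>R grad (xh t) (Sh t))"
    unfolding steps(1)[OF assms] steps(3)[OF assms] by (rule closest_point_step_dist[OF X])
  then show ?thesis
    using step_norm[OF S_subset, of t "x t"] step_norm[OF Sh_feasible(1)[OF assms], of "xh t"] assms
    by simp
qed

lemma dist_xh_x:
  assumes "t \<in> {1..T}" "x t \<in> X" shows "norm (xh t - x t) \<le> \<gamma> * M"
proof -
  have "norm (closest_point X (x t - \<gamma> *\<^sub>R grad (x t) (S t)) - closest_point X (x t - 0))
    \<le> norm (\<gamma> *\<^sub>R grad (x t) (S t)) + norm (0::'a)"
    by (rule closest_point_step_dist[OF X])
  then show ?thesis
    using step_norm[OF S_subset, of t "x t"] assms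
    by (simp add: steps(1)[OF assms(1), symmetric] closest_point_self)
qed

text \<open>The starting point need not lie in \<open>X\<close>; the first step then contributes an additional
  \<open>R\<close>.\<close>

lemma dist_xh_x_general:
  assumes "t \<in> {1..T}"
  shows "norm (xh t - x t) \<le> \<gamma> * M + (if t = 1 then R else 0)"
proof (cases "t = 1")
  case True
  moreover have "0 \<le> \<gamma> * M" using \<gamma> M_nonneg by simp
  ultimately show ?thesis using R[OF xh_in[OF assms]] start by simp
next
  case False
  then obtain s where "t = Suc s" "s \<in> {1..T}" using assms by (cases t) auto
  then show ?thesis using dist_xh_x[OF assms] x_Suc_in False by simp
qed

lemma point_player_regret:
  assumes z: "z \<in> X"
  shows "(\<Sum>t=1..T. f (xh t) (Sh t) - f z (Sh t))
           \<le> R\<^sup>2 / (2 * \<gamma>) + real T * (3 / 2 * \<gamma> * M\<^sup>2) + M * R"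
proof -
  define P where "P t = (norm (x t - z))\<^sup>2 / (2 * \<gamma>)" for t
  have step: "f (xh t) (Sh t) - f z (Sh t)
      \<le> - (P (Suc t) - P t) + 3 / 2 * \<gamma> * M\<^sup>2 + (if t = 1 then M * R else 0)"
    if t: "t \<in> {1..T}" for t
  proof -
    let ?g = "grad (xh t) (Sh t)"
    note Sh = Sh_feasible(1)[OF t]
    have "f (xh t) (Sh t) - f z (Sh t) \<le> ?g \<bullet> (xh t - z)"
      using tangent[OF Sh] .
    also have "\<dots> = ?g \<bullet> (x t - z) + ?g \<bullet> (xh t - x t)"
      by (simp add: inner_diff)
    also have "?g \<bullet> (x t - z) \<le> - (P (Suc t) - P t) + \<gamma> / 2 * M\<^sup>2"
    proof -
      have "2 * ((\<gamma> *\<^sub>R ?g) \<bullet> (x t - z))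
          \<le> (norm (x t - z))\<^sup>2 - (norm (x (Suc t) - z))\<^sup>2 + (norm (\<gamma> *\<^sub>R ?g))\<^sup>2"
        using projected_gradient_step[OF X(1,2) z] steps(3)[OF t] by metis
      also have "(norm (\<gamma> *\<^sub>R ?g))\<^sup>2 \<le> (\<gamma> * M)\<^sup>2"
        using step_norm[OF Sh] by (intro power_mono) auto
      finally have "2 * \<gamma> * (?g \<bullet> (x t - z))
          \<le> (norm (x t - z))\<^sup>2 - (norm (x (Suc t) - z))\<^sup>2 + (\<gamma> * M)\<^sup>2"
        by (simp add: mult.assoc)
      then show ?thesis
        unfolding P_def using \<gamma> by (simp add: field_simps power2_eq_square)
    qed
    also have "?g \<bullet> (xh t - x t) \<le> M * (\<gamma> * M + (if t = 1 then R else 0))"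
      using grad_inner_le[OF Sh, of "xh t" "xh t - x t"]
        mult_left_mono[OF dist_xh_x_general[OF t] M_nonneg] by linarith
    finally show ?thesis by (auto simp: power2_eq_square algebra_simps)
  qed
  have "(\<Sum>t=1..T. f (xh t) (Sh t) - f z (Sh t))
      \<le> (\<Sum>t=1..T. - (P (Suc t) - P t) + 3 / 2 * \<gamma> * M\<^sup>2 + (if t = 1 then M * R else 0))"
    by (intro sum_mono step)
  also have "\<dots> = P 1 - P (Suc T) + real T * (3 / 2 * \<gamma> * M\<^sup>2) + M * R"
    using sum_Suc_diff[of 1 T P] T by (simp only: sum.distrib sum_negf) simp
  finally have "(\<Sum>t=1..T. f (xh t) (Sh t) - f z (Sh t))
      \<le> P 1 - P (Suc T) + real T * (3 / 2 * \<gamma> * M\<^sup>2) + M * R" .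
  moreover have "P 1 \<le> R\<^sup>2 / (2 * \<gamma>)"
    using R[OF z] start \<gamma> by (simp add: P_def divide_right_mono power_mono)
  moreover have "P (Suc T) \<ge> 0"
    using \<gamma> by (simp add: P_def)
  ultimately show ?thesis by linarith
qed

lemma set_player_regret:
  assumes A: "A \<subseteq> V" "card A \<le> k"
    and B: "\<And>y S. y \<in> X \<Longrightarrow> S \<subseteq> V \<Longrightarrow> f y S \<le> B"
  shows "(\<Sum>t=1..T. f (xh t) A - 2 * f (xh t) (Sh t)) \<le> real k * (B + real T * (3 * \<gamma> * M\<^sup>2))"
proof -
  \<comment> \<open>After the last step there is no further \<open>Sh\<close>, so the potential is closed off with \<open>B\<close>.\<close>
  define P where "P t = (if t = Suc T then B else f (xh t) (Sh t))" for t
  have next_value: "f (xh t) (S (Suc t)) \<le> P (Suc t) + 3 * \<gamma> * M\<^sup>2" if t: "t \<in> {1..T}" for t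
  proof (cases "t = T")
    case True
    then have "f (xh t) (S (Suc t)) \<le> B" using B xh_in[OF t] S_subset[of "Suc t"] by simp
    also have "\<dots> \<le> B + 3 * \<gamma> * M\<^sup>2" using \<gamma> by simp
    finally show ?thesis using True by (simp add: P_def)
  next
    case False
    then have t': "Suc t \<in> {1..T}" using t by auto
    have "f (xh t) (S (Suc t)) \<le> f (x (Suc t)) (S (Suc t)) + M * norm (xh t - x (Suc t))"
      using lipschitz S_subset t' by auto
    also have "f (x (Suc t)) (S (Suc t)) \<le> f (x (Suc t)) (Sh (Suc t))"
      using rep_greedy_increasing[OF steps(2)[OF t'] mono] S_subset t' by auto
    also have "\<dots> \<le> f (xh (Suc t)) (Sh (Suc t)) + M * norm (xh (Suc t) - x (Suc t))"
      using lipschitz[OF Sh_feasible(1)[OF t']] by (metis norm_minus_commute)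
    finally have "f (xh t) (S (Suc t)) \<le> f (xh (Suc t)) (Sh (Suc t))
        + M * norm (xh (Suc t) - x (Suc t)) + M * norm (xh t - x (Suc t))" by simp
    moreover have "M * norm (xh (Suc t) - x (Suc t)) \<le> M * (\<gamma> * M)"
      using dist_xh_x[OF t' x_Suc_in[OF t]] M_nonneg by (rule mult_left_mono)
    moreover have "M * norm (xh t - x (Suc t)) \<le> M * (2 * \<gamma> * M)"
      using dist_xh_x_Suc[OF t] M_nonneg by (rule mult_left_mono)
    ultimately show ?thesis using False by (simp add: P_def power2_eq_square algebra_simps)
  qed
  have step: "f (xh t) A - 2 * f (xh t) (Sh t) \<le> real k * (P (Suc t) - P t + 3 * \<gamma> * M\<^sup>2)"
    if t: "t \<in> {1..T}" for t
  proof -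
    have "f (xh t) A - 2 * f (xh t) (Sh t) \<le> real k * (f (xh t) (S (Suc t)) - f (xh t) (Sh t))"
      using rep_greedy_progress[OF steps(4)[OF t] fin mono sub nonneg Sh_feasible(1)[OF t] A] by simp
    also have "\<dots> \<le> real k * (P (Suc t) - P t + 3 * \<gamma> * M\<^sup>2)"
      using next_value[OF t] t by (intro mult_left_mono) (auto simp: P_def)
    finally show ?thesis .
  qed
  have "(\<Sum>t=1..T. f (xh t) A - 2 * f (xh t) (Sh t))
      \<le> (\<Sum>t=1..T. real k * (P (Suc t) - P t + 3 * \<gamma> * M\<^sup>2))"
    by (intro sum_mono step)
  also have "\<dots> = real k * (P (Suc T) - P 1 + real T * (3 * \<gamma> * M\<^sup>2))"
    using sum_Suc_diff[of 1 T P] T by (simp add: sum_distrib_left[symmetric] sum.distrib)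
  also have "\<dots> \<le> real k * (B + real T * (3 * \<gamma> * M\<^sup>2))"
    using nonneg[OF Sh_feasible(1), of 1 "xh 1"] T by (intro mult_left_mono) (auto simp: P_def)
  finally show ?thesis .
qed

lemma egrg_output_jensen:
  assumes "A \<subseteq> V"
  shows "f (egrg_output (\<lambda>_. \<gamma>) T xh) A \<le> (\<Sum>t=1..T. f (xh t) A) / real T"
proof -
  have "egrg_output (\<lambda>_. \<gamma>) T xh = (\<Sum>t=1..T. (1 / real T) *\<^sub>R xh t)"
    using \<gamma> by (simp add: egrg_output_def scaleR_sum_right divide_simps)
  moreover have "f (\<Sum>t=1..T. (1 / real T) *\<^sub>R xh t) A \<le> (\<Sum>t=1..T. (1 / real T) * f (xh t) A)"
    using T by (intro convex_on_sum[OF _ _ conv[OF assms]]) auto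
  ultimately show ?thesis by (simp add: sum_divide_distrib)
qed

lemma egrg_gap:
  fixes B :: real
  assumes B: "\<And>y S. y \<in> X \<Longrightarrow> S \<subseteq> V \<Longrightarrow> f y S \<le> B" and z: "z \<in> X"
  shows "1 / 2 * max_value V f k (egrg_output (\<lambda>_. \<gamma>) T xh)
    \<le> max_value V f k z + R\<^sup>2 / (2 * \<gamma> * real T) + 3 * k * M\<^sup>2 * \<gamma> + (M * R + k * B / 2) / real T"
    (is "1 / 2 * ?m \<le> ?r")
proof -
  have "?m \<le> 2 * ?r"
  proof (rule max_value_leI)
    fix A assume A: "A \<subseteq> V" "card A \<le> k"
    have "(\<Sum>t=1..T. f z (Sh t)) \<le> real T * max_value V f k z"
      using sum_bounded_above[of "{1..T}" "\<lambda>t. f z (Sh t)" "max_value V f k z"]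
        value_le_max_value Sh_feasible by simp
    moreover have "(\<Sum>t=1..T. f (xh t) A - 2 * f (xh t) (Sh t))
        \<le> real k * (B + real T * (3 * \<gamma> * M\<^sup>2))"
      using set_player_regret[OF A] B by blast
    moreover note point_player_regret[OF z]
    moreover have "s \<le> 2 * (m + p) + q" if "b \<le> m" "s - 2 * h \<le> q" "h - b \<le> p"
      for b h m p q s :: real
      using that by (simp add: algebra_simps)
    ultimately have "(\<Sum>t=1..T. f (xh t) A) \<le> 2 * (real T * max_value V f k z + (R\<^sup>2 / (2 * \<gamma>)
        + real T * (3 / 2 * \<gamma> * M\<^sup>2) + M * R)) + real k * (B + real T * (3 * \<gamma> * M\<^sup>2))"
      unfolding sum_subtractf sum_distrib_left[symmetric] by blast
    also have "\<dots> \<le> real T * (2 * ?r)"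
    proof -
      have "1 * (real T * (3 * \<gamma> * M\<^sup>2)) \<le> real k * (real T * (3 * \<gamma> * M\<^sup>2))"
        using k \<gamma> by (intro mult_right_mono) auto
      then show ?thesis using T \<gamma> by (simp add: field_simps)
    qed
    finally have "(\<Sum>t=1..T. f (xh t) A) / real T \<le> 2 * ?r"
      using T by (simp add: pos_divide_le_eq mult.commute)
    then show "f (egrg_output (\<lambda>_. \<gamma>) T xh) A \<le> 2 * ?r"
      using egrg_output_jensen[OF A(1)] by linarith
  qed
  moreover have "1 / 2 * a \<le> b" if "a \<le> 2 * b" for a b :: real using that by simp
  ultimately show ?thesis by blast
qed

end

section \<open>Choice of the parameters\<close>

theorem theorem6:
  fixes V :: "'v set" and k :: nat
    and X :: "'a::euclidean_space set"
    and f :: "'a \<Rightarrow> 'v set \<Rightarrow> real"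
    and grad :: "'a \<Rightarrow> 'v set \<Rightarrow> 'a"
    and L M :: real
  assumes "finite V" and "1 \<le> k" and "k \<le> card V"
    and "convex X" and "bounded X" and "closed X" and "X \<noteq> {}"
    and "\<And>x S. S \<subseteq> V \<Longrightarrow> 0 \<le> f x S"
    and "\<And>S. S \<subseteq> V \<Longrightarrow> convex_on UNIV (\<lambda>x. f x S)"
    and "\<And>x. mono_on (Pow V) (f x)"
    and "\<And>x. submodular_on V (f x)"
    and "\<And>x S. S \<subseteq> V \<Longrightarrow> GDERIV (\<lambda>z. f z S) x :> grad x S"
    and "\<And>x x' S. S \<subseteq> V \<Longrightarrow> card S \<le> k \<Longrightarrow>
           norm (grad x S - grad x' S) \<le> L * norm (x - x')"
    and "\<And>x S. S \<subseteq> V \<Longrightarrow> norm (grad x S) \<le> M"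
  shows "\<exists>C\<^sub>T>0. \<exists>C\<^sub>\<gamma>>0. \<exists>\<epsilon>\<^sub>0>0. \<forall>\<epsilon>::real. 0 < \<epsilon> \<and> \<epsilon> < \<epsilon>\<^sub>0 \<longrightarrow>
           (\<exists>(T::nat) \<gamma>. 1 \<le> T \<and> real T \<le> C\<^sub>T / \<epsilon>\<^sup>2 \<and>
              (\<forall>t\<in>{1..T}. 0 < \<gamma> t \<and> \<gamma> t \<le> C\<^sub>\<gamma> * \<epsilon>) \<and>
              (\<forall>x xh S Sh. egrg_run V f grad k X \<gamma> T x xh S Sh \<longrightarrow>
                 approx_minimax V f k X (1/2) \<epsilon> (egrg_output \<gamma> T xh)))"
proof -
  obtain R where R_pos: "0 < R" and R_bound: "\<And>y. y \<in> X \<Longrightarrow> norm y \<le> R"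
    using \<open>bounded X\<close> unfolding bounded_pos by blast
  interpret minimax_problem V k X f grad M R
    using assms R_bound by unfold_locales auto
  obtain B where B: "0 \<le> B" "\<And>x S. x \<in> X \<Longrightarrow> S \<subseteq> V \<Longrightarrow> f x S \<le> B"
    using values_bounded by blast
  \<comment> \<open>With step size \<open>\<epsilon> / K\<close> the error term of \<open>egrg_gap\<close> that is linear in \<open>\<gamma>\<close> is at most
    \<open>\<epsilon> / 2\<close>. Each of the other two is at most \<open>\<epsilon> / 4\<close> once \<open>T\<close> is at least \<open>c\<^sub>1 / \<epsilon>\<^sup>2\<close>
    and \<open>c\<^sub>2 / \<epsilon>\<^sup>2\<close>, respectively; the bound for the last one uses \<open>\<epsilon> < 1\<close>.\<close>
  define K where "K = 6 * k * M\<^sup>2 + 1"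
  define c\<^sub>1 where "c\<^sub>1 = 2 * R\<^sup>2 * K"
  define c\<^sub>2 where "c\<^sub>2 = 4 * (M * R + k * B / 2)"
  define c where "c = c\<^sub>1 + c\<^sub>2"
  have K: "1 \<le> K" by (simp add: K_def)
  have c12: "0 \<le> c\<^sub>1" "0 \<le> c\<^sub>2"
    using K R_pos B M_nonneg by (simp_all add: c\<^sub>1_def c\<^sub>2_def)
  then have c: "0 \<le> c" by (simp add: c_def)
  have main: "\<exists>(T::nat) \<gamma>. 1 \<le> T \<and> real T \<le> (c + 1) / \<epsilon>\<^sup>2 \<and>
              (\<forall>t\<in>{1..T}. 0 < \<gamma> t \<and> \<gamma> t \<le> 1 / K * \<epsilon>) \<and>
              (\<forall>x xh S Sh. egrg_run V f grad k X \<gamma> T x xh S Sh \<longrightarrow>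
                 approx_minimax V f k X (1/2) \<epsilon> (egrg_output \<gamma> T xh))"
    if \<epsilon>: "0 < \<epsilon>" "\<epsilon> < 1" for \<epsilon> :: real
  proof -
    define T where "T = nat \<lfloor>(c + 1) / \<epsilon>\<^sup>2\<rfloor>"
    define \<gamma> where "\<gamma> = \<epsilon> / K"
    have \<epsilon>2: "0 < \<epsilon>\<^sup>2" "\<epsilon>\<^sup>2 \<le> \<epsilon>" using \<epsilon> by (auto simp: power2_eq_square)
    have \<epsilon>21: "\<epsilon>\<^sup>2 \<le> 1" using \<epsilon>2 \<epsilon> by linarith
    have T_le: "real T \<le> (c + 1) / \<epsilon>\<^sup>2"
      using c \<epsilon>2 by (simp add: T_def)
    have "(c + 1) / \<epsilon>\<^sup>2 - 1 \<le> real T" unfolding T_def by linarith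
    moreover have "1 \<le> 1 / \<epsilon>\<^sup>2" using \<epsilon>2(1) \<epsilon>21 by simp
    ultimately have T_ge: "c / \<epsilon>\<^sup>2 \<le> real T" by (simp add: add_divide_distrib)
    have "1 \<le> (c + 1) / \<epsilon>\<^sup>2" using \<epsilon>2(1) \<epsilon>21 c by (simp add: pos_le_divide_eq)
    then have T1: "1 \<le> T" unfolding T_def by linarith
    have \<gamma>: "0 < \<gamma>" using \<epsilon> K by (simp add: \<gamma>_def)
    have cT: "c \<le> \<epsilon>\<^sup>2 * real T" using T_ge \<epsilon>2 by (simp add: pos_divide_le_eq mult.commute)
    have gap: "R\<^sup>2 / (2 * \<gamma> * real T) + 3 * k * M\<^sup>2 * \<gamma> + (M * R + k * B / 2) / real T \<le> \<epsilon>"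
    proof -
      have "c\<^sub>1 \<le> \<epsilon>\<^sup>2 * real T" using cT c12 unfolding c_def by linarith
      then have "R\<^sup>2 / (2 * \<gamma> * real T) \<le> \<epsilon> / 4"
        using \<epsilon> K T1 by (simp add: c\<^sub>1_def \<gamma>_def field_simps power2_eq_square)
      moreover have "3 * k * M\<^sup>2 * \<gamma> \<le> \<epsilon> / 2"
        using \<epsilon> K by (simp add: \<gamma>_def field_simps) (simp add: K_def field_simps)
      moreover have "c\<^sub>2 \<le> \<epsilon> * real T"
      proof -
        have "c\<^sub>2 \<le> \<epsilon>\<^sup>2 * real T" using cT c12 unfolding c_def by linarith
        also have "\<dots> \<le> \<epsilon> * real T" using \<epsilon>2 by (intro mult_right_mono) auto
        finally show ?thesis .
      qed
      then have "(M * R + k * B / 2) / real T \<le> \<epsilon> / 4"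
        using T1 by (simp add: c\<^sub>2_def field_simps)
      ultimately show ?thesis by linarith
    qed
    have "approx_minimax V f k X (1/2) \<epsilon> (egrg_output (\<lambda>_. \<gamma>) T xh)"
      if run: "egrg_run V f grad k X (\<lambda>_. \<gamma>) T x xh S Sh" for x xh S Sh
    proof -
      interpret minimax_run V k X f grad M R \<gamma> T x xh S Sh
        using \<gamma> T1 run by unfold_locales
      have "1 / 2 * max_value V f k (egrg_output (\<lambda>_. \<gamma>) T xh) - \<epsilon> \<le> (INF y\<in>X. max_value V f k y)"
      proof (rule cINF_greatest[OF \<open>X \<noteq> {}\<close>])
        fix z assume "z \<in> X"
        from egrg_gap[OF B(2) this] gap
        show "1 / 2 * max_value V f k (egrg_output (\<lambda>_. \<gamma>) T xh) - \<epsilon> \<le> max_value V f k z"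
          by linarith
      qed
      then show ?thesis unfolding approx_minimax_def by linarith
    qed
    then show ?thesis
      using T1 T_le \<gamma> by (intro exI[of _ T] exI[of _ "\<lambda>_. \<gamma>"]) (auto simp: \<gamma>_def)
  qed
  show ?thesis
    using main c K
    by (intro exI[of _ "c + 1"] exI[of _ "1 / K"] exI[of _ "1::real"] conjI allI impI) auto
qed

end
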